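(* Let $A$ be a finitely generated commutative unital $\mathbb{C}$-algebra and let $f : A \to \mathbb{C}$ be a Frobenius $n$-homomorphism. Then there are ring homomorphisms $f_1,\dots,f_n : A \to \mathbb{C}$ such that $f = f_1 + f_2 + \dots + f_n$.
   Context: For a $\mathbb{C}$-linear map $f : A \to \mathbb{C}$ and $m \ge 1$, define $\Phi_m(f) : A^m \to \mathbb{C}$ by $\Phi_m(f)(a_1,\dots,a_m) = \sum_{\sigma \in \Sigma_m} \epsilon(\sigma) f_\sigma(a_1,\dots,a_m)$, where $\Sigma_m$ is the symmetric group, $\epsilon(\sigma)$ is the sign of $\sigma$, and if $\sigma = \gamma_1\gamma_2\cdots\gamma_q$ is the decomposition of $\sigma$ into disjoint cycles (including cycles of length one) then $f_\sigma = f_{\gamma_1} f_{\gamma_2}\cdots f_{\gamma_q}$, where for a cycle $\gamma = (r_1\, r_2\, \dots\, r_k)$ one sets $f_\gamma(a_1,\dots,a_m) = f(a_{r_1}a_{r_2}\cdots a_{r_k})$. (E.g. $\Phi_1(f)=f$, $\Phi_2(f)(a,b)=f(a)f(b)-f(ab)$.) A $\mathbb{C}$-linear map $f$ is a Frobenius $n$-homomorphism if $\Phi_{n+1}(f)$ vanishes identically and $f(1) = n$. Here "ring homomorphism" $A\to\mathbb{C}$ means a $\mathbb{C}$-linear map preserving products and the unit. *)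

theory Defs
  imports Complex_Main "HOL-Combinatorics.Orbits"
begin

text \<open>
  A commutative unital algebra over the complex numbers is a type of class \<open>comm_ring_1\<close> with a
  scalar multiplication. The class excludes the zero algebra, on which no linear map satisfies
  \<open>f 1 = n\<close> unless \<open>n = 0\<close>.
\<close>

locale complex_algebra = vector_space scale
  for scale :: "complex \<Rightarrow> 'a::comm_ring_1 \<Rightarrow> 'a" +
  assumes scale_mult_left: "scale c x * y = scale c (x * y)"

definition subalgebra :: "(complex \<Rightarrow> 'a::comm_ring_1 \<Rightarrow> 'a) \<Rightarrow> 'a set \<Rightarrow> bool" where
  "subalgebra scale B \<longleftrightarrow>
     module.subspace scale B \<and> 1 \<in> B \<and> (\<forall>x\<in>B. \<forall>y\<in>B. x * y \<in> B)"

definition finitely_generated :: "(complex \<Rightarrow> 'a::comm_ring_1 \<Rightarrow> 'a) \<Rightarrow> bool" where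
  "finitely_generated scale \<longleftrightarrow> (\<exists>S. finite S \<and> subalgebra scale hull S = UNIV)"

definition complex_linear :: "(complex \<Rightarrow> 'a::comm_ring_1 \<Rightarrow> 'a) \<Rightarrow> ('a \<Rightarrow> complex) \<Rightarrow> bool" where
  "complex_linear scale f \<longleftrightarrow> Vector_Spaces.linear scale (*) f"

definition algebra_hom :: "(complex \<Rightarrow> 'a::comm_ring_1 \<Rightarrow> 'a) \<Rightarrow> ('a \<Rightarrow> complex) \<Rightarrow> bool" where
  "algebra_hom scale g \<longleftrightarrow>
     complex_linear scale g \<and> g 1 = 1 \<and> (\<forall>x y. g (x * y) = g x * g y)"

text \<open>
  The disjoint cycles of a permutation of \<open>{1..m}\<close>, fixed points included, are represented by
  its orbits. As the algebra is commutative, the product \<open>a r\<^sub>1 * \<dots> * a r\<^sub>k\<close> along a cycle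
  depends only on the underlying orbit \<open>{r\<^sub>1, \<dots>, r\<^sub>k}\<close>.
\<close>

definition perm_cycles :: "nat \<Rightarrow> (nat \<Rightarrow> nat) \<Rightarrow> nat set set" where
  "perm_cycles m \<sigma> = orbit \<sigma> ` {1..m}"

definition f_cycle :: "('a::comm_ring_1 \<Rightarrow> complex) \<Rightarrow> nat set \<Rightarrow> (nat \<Rightarrow> 'a) \<Rightarrow> complex" where
  "f_cycle f \<gamma> a = f (\<Prod>r\<in>\<gamma>. a r)"

definition f_perm ::
  "nat \<Rightarrow> ('a::comm_ring_1 \<Rightarrow> complex) \<Rightarrow> (nat \<Rightarrow> nat) \<Rightarrow> (nat \<Rightarrow> 'a) \<Rightarrow> complex" where
  "f_perm m f \<sigma> a = (\<Prod>\<gamma>\<in>perm_cycles m \<sigma>. f_cycle f \<gamma> a)"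

text \<open>An \<open>m\<close>-tuple is a function on \<open>nat\<close> of which only the values on \<open>{1..m}\<close> are used.\<close>

definition Phi :: "nat \<Rightarrow> ('a::comm_ring_1 \<Rightarrow> complex) \<Rightarrow> (nat \<Rightarrow> 'a) \<Rightarrow> complex" where
  "Phi m f a = (\<Sum>\<sigma> | \<sigma> permutes {1..m}. of_int (sign \<sigma>) * f_perm m f \<sigma> a)"

definition frobenius_hom ::
  "(complex \<Rightarrow> 'a::comm_ring_1 \<Rightarrow> 'a) \<Rightarrow> nat \<Rightarrow> ('a \<Rightarrow> complex) \<Rightarrow> bool" where
  "frobenius_hom scale n f \<longleftrightarrow>
     complex_linear scale f \<and> (\<forall>a. Phi (n + 1) f a = 0) \<and> f 1 = of_nat n"

end

theory Submission
  imports Defs "HOL-Computational_Algebra.Fundamental_Theorem_Algebra"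
begin

text \<open>
  Let \<open>N\<close> be the ideal of all \<open>x\<close> with \<open>f (x * y) = 0\<close> for every \<open>y\<close>, and write
  \<open>T\<^sub>m x = \<Phi>\<^sub>m\<^sub>+\<^sub>1(x, b, \<dots>, b)\<close>. Inserting one more point into the permutations gives
  \<open>T\<^sub>m\<^sub>+\<^sub>1 x = f x * T\<^sub>m b - (m + 1) * T\<^sub>m (x * b)\<close>, and the vanishing of \<open>T\<^sub>n\<close> has three
  consequences: every element is algebraic modulo \<open>N\<close>; \<open>N\<close> is a radical ideal; and an
  idempotent \<open>e\<close> modulo \<open>N\<close> that is not in \<open>N\<close> has \<open>f e \<in> {1..n}\<close>. By induction on \<open>f e\<close>,
  the functional \<open>x \<mapsto> f (e * x)\<close> is a sum of \<open>f e\<close> characters: if every \<open>e * b\<close> is a scalar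
  multiple of \<open>e\<close> modulo \<open>N\<close>, then it is \<open>f e\<close> times one character; otherwise the minimal
  polynomial of some \<open>b\<close> splits \<open>e\<close> into two smaller idempotents. The theorem is the case
  \<open>e = 1\<close>.
\<close>

section \<open>Inserting a point into a permutation\<close>

text \<open>The composite sends the \<open>q\<close>-preimage of \<open>i\<close> to
  \<open>s\<close> and \<open>s\<close> to \<open>i\<close>: it splices \<open>s\<close> into the
  cycle of \<open>i\<close>, just before \<open>i\<close>, and leaves all other cycles
  alone.\<close>

lemma orbit_transpose_comp:
  assumes q: "q permutes S" and "s \<notin> S" "i \<in> S" "r \<in> S"
  shows "orbit (transpose s i \<circ> q) r =
    (if i \<in> orbit q r then insert s (orbit q r) else orbit q r)"
    (is "orbit ?t r = ?h")
proof
  have qs: "q s = s" using q \<open>s \<notin> S\<close> by (rule permutes_not_in)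
  have sub: "orbit q r \<subseteq> S" using permutes_orbit_subset[OF q \<open>r \<in> S\<close>] .
  have ns: "q y \<noteq> s" if "y \<in> S" for y
    using that permutes_in_image[OF q] \<open>s \<notin> S\<close> by metis
  have tval: "?t y = (if q y = i then s else q y)" if "y \<in> S" for y
    using ns[OF that] by (auto simp: transpose_def)
  have ts: "?t s = i" using qs by simp
  show "orbit ?t r \<subseteq> ?h"
  proof
    fix y assume "y \<in> orbit ?t r"
    then show "y \<in> ?h"
    proof induction
      case base
      have "q r \<in> orbit q r" by (rule orbit.base)
      then show ?case using tval[OF \<open>r \<in> S\<close>] by auto
    next
      case (step y)
      show ?case
      proof (cases "y = s")
        case True
        then have "i \<in> orbit q r" using step.IH sub \<open>s \<notin> S\<close> by (auto split: if_splits)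
        then show ?thesis using ts True by simp
      next
        case False
        then have y: "y \<in> orbit q r" using step.IH by (auto split: if_splits)
        then have "q y \<in> orbit q r" by (rule orbit.step)
        moreover have "y \<in> S" using y sub by blast
        ultimately show ?thesis using tval[of y] by (auto simp del: comp_apply)
      qed
    qed
  qed
  \<comment> \<open>One step of \<open>q\<close> is imitated by one step of the composite, or by two
    with a stop at \<open>s\<close> when the step ends in \<open>i\<close>.\<close>
  have reach: "q y \<in> orbit ?t r \<and> (q y = i \<longrightarrow> s \<in> orbit ?t r)"
    if "y \<in> S" "?t y \<in> orbit ?t r" for y
  proof (cases "q y = i")
    case True
    then have "s \<in> orbit ?t r" using that tval by simp
    moreover from this have "?t s \<in> orbit ?t r" by (rule orbit.step)
    ultimately show ?thesis using ts True by simp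
  next
    case False
    then show ?thesis using that tval by simp
  qed
  have "y \<in> orbit ?t r \<and> (y = i \<longrightarrow> s \<in> orbit ?t r)" if "y \<in> orbit q r" for y
    using that
  proof induction
    case base
    show ?case by (rule reach[OF \<open>r \<in> S\<close> orbit.base])
  next
    case (step y)
    then have "?t y \<in> orbit ?t r" by (blast intro: orbit.step)
    then show ?case using reach step.hyps sub by blast
  qed
  then show "?h \<subseteq> orbit ?t r" by auto
qed

lemma orbits_transpose_comp:
  assumes q: "q permutes S" and fin: "finite S" and s: "s \<notin> S" and i: "i \<in> S"
  shows "orbit (transpose s i \<circ> q) ` insert s S =
    (\<lambda>\<gamma>. if i \<in> \<gamma> then insert s \<gamma> else \<gamma>) ` orbit q ` S"
proof -
  let ?t = "transpose s i \<circ> q"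
  have t: "permutation ?t"
    using permutation_compose permutation_swap_id permutation_permutes q fin by metis
  have "?t s = i" using permutes_not_in[OF q s] by simp
  then have "orbit ?t s = orbit ?t i" using permutation_orbit_step[OF t] by metis
  then have "orbit ?t ` insert s S = orbit ?t ` S" using i by auto
  also have "\<dots> = (\<lambda>\<gamma>. if i \<in> \<gamma> then insert s \<gamma> else \<gamma>) ` orbit q ` S"
    using orbit_transpose_comp[OF q s i] by (auto simp: image_image)
  finally show ?thesis .
qed

text \<open>\<open>\<Phi>\<close> over an arbitrary finite index set, so that an index can be removed without renumbering.\<close>

definition Phi_on :: "'i set \<Rightarrow> ('a::comm_ring_1 \<Rightarrow> complex) \<Rightarrow> ('i \<Rightarrow> 'a) \<Rightarrow> complex" where
  "Phi_on S f a = (\<Sum>\<sigma> | \<sigma> permutes S. of_int (sign \<sigma>) * (\<Prod>\<gamma>\<in>orbit \<sigma> ` S. f (\<Prod>r\<in>\<gamma>. a r)))"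

lemma Phi_eq_Phi_on: "Phi m f a = Phi_on {1..m} f a"
  by (simp add: Phi_def Phi_on_def f_perm_def f_cycle_def perm_cycles_def)

text \<open>By commutativity, a cycle enlarged by \<open>s\<close> can be read as the old cycle
  whose \<open>i\<close>-th entry has absorbed \<open>a s\<close>.\<close>

lemma prod_fun_upd_mult:
  fixes a :: "'i \<Rightarrow> 'a::comm_monoid_mult"
  assumes "finite A" "s \<notin> A"
  shows "prod a (if i \<in> A then insert s A else A) = prod (a(i := a i * a s)) A"
proof (cases "i \<in> A")
  case True
  have "prod (a(i := a i * a s)) A = a i * a s * prod a (A - {i})"
    using assms True by (subst prod.remove[of _ i]) (auto intro!: arg_cong2[where f="(*)"] prod.cong)
  also have "\<dots> = a s * prod a A"
    using assms True by (subst (2) prod.remove[of _ i]) (auto simp: ac_simps)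
  finally show ?thesis using True assms by simp
next
  case False
  then show ?thesis by (auto intro!: prod.cong)
qed

text \<open>A permutation of \<open>insert s S\<close> either fixes \<open>s\<close>, which adds a
  factor \<open>f (a s)\<close>, or is uniquely \<open>transpose s i \<circ> q\<close> with
  \<open>i \<in> S\<close>, which flips the sign and merges \<open>a s\<close> into entry
  \<open>i\<close>.\<close>

lemma Phi_on_insert:
  fixes a :: "'i \<Rightarrow> 'a::comm_ring_1"
  assumes fin: "finite S" and s: "s \<notin> S"
  shows "Phi_on (insert s S) f a =
    f (a s) * Phi_on S f a - (\<Sum>i\<in>S. Phi_on S f (a(i := a i * a s)))"
proof -
  let ?F = "\<lambda>T a \<sigma>. of_int (sign \<sigma>) * (\<Prod>\<gamma>\<in>orbit \<sigma> ` T. f (\<Prod>r\<in>\<gamma>. a r))"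
  have fixed: "?F (insert s S) a q = f (a s) * ?F S a q" if q: "q permutes S" for q
  proof -
    have orb: "orbit q s = {s}" using permutes_not_in[OF q s] by (simp add: orbit_eq_singleton_iff)
    have "{s} \<notin> orbit q ` S" using permutes_orbit_subset[OF q] s by blast
    then show ?thesis using fin orb by simp
  qed
  have moved: "?F (insert s S) a (transpose s i \<circ> q) = - ?F S (a(i := a i * a s)) q"
    if q: "q permutes S" and i: "i \<in> S" for q i
  proof -
    let ?h = "\<lambda>\<gamma>. if i \<in> \<gamma> then insert s \<gamma> else \<gamma>"
    have sub: "\<gamma> \<subseteq> S" if "\<gamma> \<in> orbit q ` S" for \<gamma>
      using that permutes_orbit_subset[OF q] by blast
    \<comment> \<open>Distinct cycles stay distinct, since deleting \<open>s\<close> recovers the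
      old cycle.\<close>
    have inj: "inj_on ?h (orbit q ` S)"
    proof (rule inj_onI)
      fix \<gamma> \<delta> assume "\<gamma> \<in> orbit q ` S" "\<delta> \<in> orbit q ` S" "?h \<gamma> = ?h \<delta>"
      then have "s \<notin> \<gamma>" "s \<notin> \<delta>" using sub s by blast+
      then show "\<gamma> = \<delta>" using \<open>?h \<gamma> = ?h \<delta>\<close> by (auto split: if_splits)
    qed
    have "(\<Prod>\<gamma>\<in>orbit (transpose s i \<circ> q) ` insert s S. f (prod a \<gamma>)) =
        (\<Prod>\<gamma>\<in>orbit q ` S. f (prod a (?h \<gamma>)))"
      unfolding orbits_transpose_comp[OF q fin s i] by (subst prod.reindex[OF inj]) simp
    also have "\<dots> = (\<Prod>\<gamma>\<in>orbit q ` S. f (prod (a(i := a i * a s)) \<gamma>))"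
    proof (rule prod.cong[OF refl])
      fix \<gamma> assume "\<gamma> \<in> orbit q ` S"
      then have "finite \<gamma>" "s \<notin> \<gamma>" using sub fin s finite_subset by blast+
      then show "f (prod a (?h \<gamma>)) = f (prod (a(i := a i * a s)) \<gamma>)"
        by (intro arg_cong[where f = f] prod_fun_upd_mult)
    qed
    finally have "(\<Prod>\<gamma>\<in>orbit (transpose s i \<circ> q) ` insert s S. f (prod a \<gamma>)) =
      (\<Prod>\<gamma>\<in>orbit q ` S. f (prod (a(i := a i * a s)) \<gamma>))" .
    moreover have "permutation q" using q fin permutation_permutes by blast
    then have "sign (transpose s i \<circ> q) = - sign q"
      using s i by (auto simp: sign_compose permutation_swap_id sign_swap_id)
    ultimately show ?thesis by simp
  qed
  have "Phi_on (insert s S) f a =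
      (\<Sum>i\<in>insert s S. \<Sum>q | q permutes S. ?F (insert s S) a (transpose s i \<circ> q))"
    unfolding Phi_on_def by (rule sum_over_permutations_insert[OF fin s])
  also have "\<dots> = (\<Sum>q | q permutes S. ?F (insert s S) a q) +
      (\<Sum>i\<in>S. \<Sum>q | q permutes S. ?F (insert s S) a (transpose s i \<circ> q))"
    \<comment> \<open>The index \<open>i = s\<close> gives \<open>transpose s s = id\<close>, hence
      the permutations fixing \<open>s\<close>.\<close>
    by (subst sum.insert[OF fin s]) simp
  also have "(\<Sum>q | q permutes S. ?F (insert s S) a q) = f (a s) * Phi_on S f a"
    unfolding Phi_on_def sum_distrib_left by (intro sum.cong refl fixed) simp
  also have "(\<Sum>i\<in>S. \<Sum>q | q permutes S. ?F (insert s S) a (transpose s i \<circ> q)) =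
      (\<Sum>i\<in>S. - Phi_on S f (a(i := a i * a s)))"
    unfolding Phi_on_def sum_negf[symmetric] by (intro sum.cong refl moved) simp_all
  finally show ?thesis by (simp add: sum_negf)
qed

text \<open>This is \<open>T\<^sub>m x\<close>; the index \<open>m\<close> counts the copies of
  \<open>b\<close>, so it is one less than the number of arguments.\<close>

primrec Phi_diag :: "('a::comm_ring_1 \<Rightarrow> complex) \<Rightarrow> 'a \<Rightarrow> nat \<Rightarrow> 'a \<Rightarrow> complex" where
  "Phi_diag f b 0 x = f x"
| "Phi_diag f b (Suc m) x = f x * Phi_diag f b m b - of_nat (Suc m) * Phi_diag f b m (x * b)"

text \<open>Remove the exceptional index \<open>s\<close>: each of the remaining indices may absorb
  \<open>a s\<close>, and the one that does becomes exceptional with entry \<open>a s * b\<close>.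
  Hence \<open>s\<close> must be arbitrary in the induction.\<close>

lemma Phi_on_eq_Phi_diag:
  assumes "finite S" "card S = Suc m" "s \<in> S" "\<And>r. r \<in> S - {s} \<Longrightarrow> a r = b"
  shows "Phi_on S f a = Phi_diag f b m (a s)"
  using assms
proof (induction m arbitrary: S s a)
  case 0
  then have "S = {s}" by (metis One_nat_def card_1_singletonE singletonD)
  then show ?case using Phi_on_insert[of "{}" s f a] by (simp add: Phi_on_def)
next
  case (Suc m)
  let ?S = "S - {s}"
  have S: "finite ?S" "card ?S = Suc m" "insert s ?S = S" using Suc.prems by auto
  have "?S \<noteq> {}" using S(2) by (metis card.empty nat.distinct(1))
  then obtain t where t: "t \<in> ?S" by blast
  have "Phi_on ?S f a = Phi_diag f b m (a t)"
    using Suc.prems(4) t by (intro Suc.IH[OF S(1,2)]) auto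
  then have base: "Phi_on ?S f a = Phi_diag f b m b" using Suc.prems(4) t by simp
  have upd: "Phi_on ?S f (a(i := a i * a s)) = Phi_diag f b m (a s * b)" if i: "i \<in> ?S" for i
  proof -
    have "Phi_on ?S f (a(i := a i * a s)) = Phi_diag f b m ((a(i := a i * a s)) i)"
      using Suc.prems(4) i by (intro Suc.IH[OF S(1,2)]) auto
    then show ?thesis using Suc.prems(4) i by (simp add: mult.commute)
  qed
  have "Phi_on S f a = f (a s) * Phi_on ?S f a - (\<Sum>i\<in>?S. Phi_on ?S f (a(i := a i * a s)))"
    using Phi_on_insert[of ?S s f a] S by simp
  also have "\<dots> = Phi_diag f b (Suc m) (a s)" using upd base S(2) by simp
  finally show ?case .
qed

section \<open>Evaluating complex polynomials in an algebra\<close>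

context complex_algebra
begin

definition poly_at :: "'a \<Rightarrow> complex poly \<Rightarrow> 'a" where
  "poly_at b p = poly (map_poly (\<lambda>c. scale c 1) p) b"

lemma scale_one_mult: "scale c 1 * x = scale c x"
  by (simp add: scale_mult_left)

lemma poly_at_0 [simp]: "poly_at b 0 = 0"
  by (simp add: poly_at_def)

lemma poly_at_pCons [simp]: "poly_at b (pCons c p) = scale c 1 + b * poly_at b p"
  by (simp add: poly_at_def map_poly_pCons)

lemma poly_at_1 [simp]: "poly_at b 1 = 1"
  by (simp add: one_pCons)

lemma poly_at_add: "poly_at b (p + q) = poly_at b p + poly_at b q"
proof -
  have "map_poly (\<lambda>c. scale c 1) (p + q) =
      map_poly (\<lambda>c. scale c 1) p + map_poly (\<lambda>c. scale c 1) q"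
    by (rule poly_eqI) (simp add: coeff_map_poly scale_left_distrib)
  then show ?thesis by (simp add: poly_at_def)
qed

lemma poly_at_smult: "poly_at b (smult c p) = scale c 1 * poly_at b p"
proof -
  have "map_poly (\<lambda>c. scale c 1) (smult c p) = smult (scale c 1) (map_poly (\<lambda>c. scale c 1) p)"
    by (rule map_poly_smult) (simp_all add: scale_one_mult)
  then show ?thesis by (simp add: poly_at_def)
qed

lemma poly_at_mult: "poly_at b (p * q) = poly_at b p * poly_at b q"
  by (induction p) (simp_all add: poly_at_add poly_at_smult algebra_simps)

lemma poly_at_diff: "poly_at b (p - q) = poly_at b p - poly_at b q"
  using poly_at_add[of b "p - q" q] by simp

end

section \<open>The null ideal\<close>

locale frobenius = complex_algebra scale
  for scale :: "complex \<Rightarrow> 'a::comm_ring_1 \<Rightarrow> 'a" +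
  fixes n :: nat and f :: "'a \<Rightarrow> complex"
  assumes frob: "frobenius_hom scale n f"
begin

lemma linear: "Vector_Spaces.linear scale (*) f"
  using frob by (simp add: frobenius_hom_def complex_linear_def)

lemma add: "f (x + y) = f x + f y"
  using linear by (simp add: Vector_Spaces.linear_iff)

lemma scale: "f (scale c x) = c * f x"
  using linear by (simp add: Vector_Spaces.linear_iff)

lemma diff: "f (x - y) = f x - f y"
  using add[of "x - y" y] by simp

lemma zero: "f 0 = 0"
  using diff[of 0 0] by simp

lemma Phi_diag_eq_0: "Phi_diag f b n x = 0"
proof -
  let ?a = "(\<lambda>_::nat. b)(1 := x)"
  have "Phi_on {1..n + 1} f ?a = Phi_diag f b n (?a 1)"
    by (rule Phi_on_eq_Phi_diag[where a = ?a]) auto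
  then show ?thesis using frob by (simp add: frobenius_hom_def Phi_eq_Phi_on)
qed

text \<open>The radical of the symmetric bilinear form \<open>f (x * y)\<close>, equivalently the
  largest ideal inside the kernel of \<open>f\<close>.\<close>

definition null :: "'a \<Rightarrow> bool" where
  "null x \<longleftrightarrow> (\<forall>y. f (x * y) = 0)"

lemma null_add: "null x \<Longrightarrow> null y \<Longrightarrow> null (x + y)"
  by (simp add: null_def distrib_right add)

lemma null_mult: "null x \<Longrightarrow> null (x * y)"
  by (simp add: null_def mult.assoc)

lemma null_diff: "null x \<Longrightarrow> null y \<Longrightarrow> null (x - y)"
  by (simp add: null_def left_diff_distrib diff)

lemma null_imp_f: "null x \<Longrightarrow> f x = 0"
  unfolding null_def by (metis mult.right_neutral)

text \<open>Unrolling the recursion writes \<open>T\<^sub>m x\<close> as \<open>f (x * q(b))\<close>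
  with \<open>q\<close> of leading coefficient \<open>(-1)^m * m!\<close>, so \<open>q\<close> is
  nonzero; \<open>T\<^sub>n = 0\<close> then makes \<open>q(b)\<close> null.\<close>

lemma algebraic: obtains p where "p \<noteq> 0" "null (poly_at b p)"
proof -
  have "\<exists>q. q \<noteq> 0 \<and> (\<forall>x. Phi_diag f b m x = f (x * poly_at b q))" for m
  proof (induction m)
    case 0
    show ?case by (rule exI[of _ 1]) simp
  next
    case (Suc m)
    then obtain q where q: "q \<noteq> 0" "\<And>x. Phi_diag f b m x = f (x * poly_at b q)" by blast
    let ?c = "Phi_diag f b m b"
    \<comment> \<open>The constant term encodes \<open>f x * T\<^sub>m b\<close>; the shift by
      \<open>pCons\<close> supplies the factor \<open>b\<close> of the other term.\<close>
    let ?q = "pCons ?c (smult (- of_nat (Suc m)) q)"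
    have "Phi_diag f b (Suc m) x = f (x * poly_at b ?q)" for x
    proof -
      have "x * poly_at b ?q = scale ?c x + scale (- of_nat (Suc m)) (x * b * poly_at b q)"
        by (simp only: poly_at_pCons poly_at_smult scale_one_mult[symmetric, of _ x]
            scale_one_mult[symmetric, of _ "x * b * poly_at b q"]) (simp add: algebra_simps)
      then show ?thesis by (simp add: diff scale q(2) mult.commute del: of_nat_Suc poly_at_pCons)
    qed
    moreover have "?q \<noteq> 0" using q(1) by (simp del: of_nat_Suc)
    ultimately show ?case by blast
  qed
  then obtain q where "q \<noteq> 0" and q: "\<And>x. Phi_diag f b n x = f (x * poly_at b q)" by blast
  have "f (poly_at b q * x) = 0" for x
    using q[of x] by (simp add: Phi_diag_eq_0 mult.commute)
  then have "null (poly_at b q)" by (simp add: null_def)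
  then show ?thesis using that \<open>q \<noteq> 0\<close> by blast
qed

text \<open>For \<open>z = w * y\<close> the square \<open>z * z\<close> is null, so the recursion
  at \<open>b = x = z\<close> loses its second term and \<open>T\<^sub>n z = f z ^ (n + 1)\<close>.
  As this is 0, \<open>f z = 0\<close>.\<close>

lemma null_square:
  assumes "null (w * w)"
  shows "null w"
  unfolding null_def
proof
  fix y
  let ?z = "w * y"
  have 0: "f (?z * ?z * u) = 0" for u
    using assms[unfolded null_def, rule_format, of "y * y * u"] by (simp add: ac_simps)
  \<comment> \<open>The extra factor \<open>u\<close> absorbs the multiplication by \<open>z\<close>
    in the recursion.\<close>
  have sq: "Phi_diag f ?z m (?z * ?z * u) = 0" for m u
  proof (induction m arbitrary: u)
    case 0
    show ?case using \<open>\<And>u. f (?z * ?z * u) = 0\<close> by simp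
  next
    case (Suc m)
    have "Phi_diag f ?z m (?z * ?z * u * ?z) = 0"
      using Suc[of "u * ?z"] by (simp add: mult.assoc)
    then show ?case using 0[of u] by simp
  qed
  have "Phi_diag f ?z m ?z = f ?z ^ Suc m" for m
  proof (induction m)
    case (Suc m)
    have "Phi_diag f ?z m (?z * ?z) = 0" using sq[of m 1] by simp
    then show ?case using Suc by simp
  qed simp
  from this[of n] show "f ?z = 0" using power_eq_0_iff[of "f ?z" "Suc n"] Phi_diag_eq_0 by metis
qed

text \<open>\<open>\<Phi>\<^sub>n\<^sub>+\<^sub>1(z, e, \<dots>, e) = f z * (f e - 1) \<cdots> (f e - n)\<close> whenever \<open>z * e = z\<close> modulo the null
  ideal.\<close>

lemma idempotent_value:
  assumes e: "null (e * e - e)" and "\<not> null e"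
  obtains k where "k \<in> {1..n}" "f e = of_nat k"
proof -
  have val: "Phi_diag f e m z = f z * (\<Prod>k\<in>{1..m}. f e - of_nat k)" if "null (z * e - z)" for m z
    using that
  proof (induction m arbitrary: z)
    case (Suc m)
    have ze: "f (z * e) = f z" using null_imp_f[OF Suc.prems] by (simp add: diff)
    have "null (z * e * e - z * e)"
      using null_mult[OF Suc.prems, of e] by (simp add: algebra_simps)
    note Suc.IH[OF this] Suc.IH[OF e]
    then show ?case using ze by (simp add: algebra_simps)
  qed simp
  obtain y where y: "f (e * y) \<noteq> 0" using \<open>\<not> null e\<close> by (auto simp: null_def)
  \<comment> \<open>The choice \<open>z = e * y\<close> keeps \<open>f z\<close> nonzero, so one of
    the factors \<open>f e - k\<close> has to vanish.\<close>
  have "null (e * y * e - e * y)" using null_mult[OF e, of y] by (simp add: algebra_simps)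
  from val[OF this, of n] y have "(\<Prod>k\<in>{1..n}. f e - of_nat k) = 0" by (simp add: Phi_diag_eq_0)
  then obtain k where "k \<in> {1..n}" "f e - of_nat k = 0" by auto
  then show ?thesis using that by simp
qed

section \<open>Splitting idempotents\<close>

text \<open>Let \<open>p\<close> be the minimal polynomial of \<open>b\<close> on the corner of
  \<open>e\<close> and \<open>z\<close> a root. The root is simple because the null ideal is
  radical, and \<open>p\<close> is not linear because \<open>e * b\<close> is not scalar, so the
  factor for \<open>z\<close> splits off an idempotent.\<close>

lemma split_idempotent:
  assumes e: "null (e * e - e)" and ne: "\<not> null e" and ns: "\<And>c. \<not> null (e * b - scale c e)"
  obtains e' where "null (e' * e' - e')" "null ((e - e') * (e - e') - (e - e'))"
    "\<not> null e'" "\<not> null (e - e')"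
proof -
  let ?A = "\<lambda>p. p \<noteq> 0 \<and> null (e * poly_at b p)"
  obtain p0 where "p0 \<noteq> 0" "null (poly_at b p0)" by (rule algebraic)
  then have "?A p0" using null_mult[of "poly_at b p0" e] by (simp add: mult.commute)
  then obtain p where p: "p \<noteq> 0" "null (e * poly_at b p)"
    and min: "\<And>q. q \<noteq> 0 \<Longrightarrow> degree q < degree p \<Longrightarrow> \<not> null (e * poly_at b q)"
    using ex_has_least_nat[of ?A p0 degree] by (metis leD)
  have null_unscale: "null x" if "null (scale c x)" "c \<noteq> 0" for c x
    using that by (simp add: null_def scale_mult_left scale)
  have "degree p \<noteq> 0"
  proof
    assume "degree p = 0"
    then obtain c where c: "p = [:c:]" by (rule degree_eq_zeroE)
    then have "null (scale c e)" using p by (simp add: scale_one_mult mult.commute[of e])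
    then show False using null_unscale c p ne by auto
  qed
  then obtain z where "poly p z = 0"
    using fundamental_theorem_of_algebra[of p] constant_degree[of p] by auto
  then obtain s where s: "p = [:- z, 1:] * s" by (auto simp: poly_eq_0_iff_dvd)
  then have s0: "s \<noteq> 0" using p by auto
  then have deg: "degree p = Suc (degree s)" unfolding s by (subst degree_mult_eq) auto
  have lin: "poly_at b [:- z, 1:] = b - scale z 1" by simp
  \<comment> \<open>A constant \<open>s\<close> would make \<open>p\<close> linear and
    \<open>e * b\<close> congruent to \<open>z\<close> times \<open>e\<close>.\<close>
  have degs: "degree s \<noteq> 0"
  proof
    assume "degree s = 0"
    then obtain c where c: "s = [:c:]" by (rule degree_eq_zeroE)
    have "e * poly_at b p = scale c 1 * (e * (b - scale z 1))"
      unfolding s poly_at_mult lin by (simp add: c ac_simps)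
    also have "\<dots> = scale c (e * b - scale z e)"
      unfolding scale_one_mult by (simp add: right_diff_distrib scale_one_mult mult.commute[of e "scale z 1"])
    finally have "null (scale c (e * b - scale z e))" using p(2) by simp
    moreover have "c \<noteq> 0" using c s0 by auto
    ultimately show False using null_unscale ns by blast
  qed
  \<comment> \<open>At a double root \<open>p\<close> divides \<open>s * s\<close>, so
    \<open>e * s(b)\<close> has null square and is null, against minimality.\<close>
  have "poly s z \<noteq> 0"
  proof
    assume "poly s z = 0"
    then obtain g where g: "s = [:- z, 1:] * g" by (auto simp: poly_eq_0_iff_dvd)
    let ?w = "e * poly_at b s"
    have "s * s = p * g" unfolding s by (subst (2) g) (simp only: ac_simps)
    then have "poly_at b s * poly_at b s = poly_at b p * poly_at b g"
      by (simp only: poly_at_mult[symmetric])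
    then have "e * e * (poly_at b s * poly_at b s) = e * e * (poly_at b p * poly_at b g)"
      by simp
    then have "?w * ?w = e * poly_at b p * (e * poly_at b g)" by (simp only: ac_simps)
    then have "null (?w * ?w)" using null_mult[OF p(2)] by simp
    then have "null ?w" by (rule null_square)
    then show False using min[OF s0] deg by simp
  qed
  \<comment> \<open>Normalised to \<open>t(z) = 1\<close>, so that \<open>p\<close> divides
    \<open>t * (t - 1)\<close> and \<open>t(b)\<close> acts as an idempotent on the corner.\<close>
  define t where "t = smult (inverse (poly s z)) s"
  have t: "t \<noteq> 0" "degree t = degree s" "poly t z = 1"
    using s0 \<open>poly s z \<noteq> 0\<close> by (simp_all add: t_def)
  have "poly (t - 1) z = 0" using t by simp
  then have "[:- z, 1:] dvd t - 1" by (simp only: poly_eq_0_iff_dvd)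
  then obtain h where h: "t - 1 = [:- z, 1:] * h" by (rule dvdE)
  define e' where "e' = e * poly_at b t"
  have "t * (t - 1) = p * smult (inverse (poly s z)) h"
    unfolding h unfolding s t_def by (simp only: mult_smult_left mult_smult_right ac_simps)
  then have "e * poly_at b (t * (t - 1)) =
      e * poly_at b p * poly_at b (smult (inverse (poly s z)) h)"
    by (simp only: poly_at_mult mult.assoc)
  then have nt: "null (e * poly_at b (t * (t - 1)))" using null_mult[OF p(2)] by simp
  have "e' * e' - e' = (e * e - e) * (poly_at b t * poly_at b t) + e * poly_at b (t * (t - 1))"
    unfolding e'_def poly_at_mult poly_at_diff poly_at_1 by (simp only: algebra_simps mult_1_left mult_1_right)
  then have 1: "null (e' * e' - e')" using null_add[OF null_mult[OF e] nt] by metis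
  have "(e - e') * (e - e') - (e - e') =
      (e * e - e) + (e' * e' - e') - (e * e - e) * (poly_at b t + poly_at b t)"
    unfolding e'_def by (simp add: algebra_simps)
  then have 2: "null ((e - e') * (e - e') - (e - e'))"
    using null_diff[OF null_add[OF e 1] null_mult[OF e]] by metis
  \<comment> \<open>Both \<open>t\<close> and \<open>1 - t\<close> are nonzero of degree below that
    of \<open>p\<close>, so minimality keeps both pieces out of the null ideal.\<close>
  have 3: "\<not> null e'" unfolding e'_def using min t deg by simp
  have "e - e' = e * poly_at b (1 - t)" unfolding e'_def poly_at_diff by (simp add: algebra_simps)
  moreover have "1 - t \<noteq> 0" using t degs by auto
  moreover have "degree (1 - t) < degree p" using degree_diff_le_max[of 1 t] t deg by simp
  ultimately have 4: "\<not> null (e - e')" using min by simp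
  show ?thesis using that 1 2 3 4 .
qed

text \<open>Strong induction on \<open>m = f e\<close> works because both pieces of a split
  idempotent have positive integer values adding up to \<open>m\<close>.\<close>

lemma corner_sum_of_homs:
  assumes "null (e * e - e)" "f e = of_nat m"
  shows "\<exists>gs. length gs = m \<and> (\<forall>g\<in>set gs. algebra_hom scale g) \<and>
    (\<forall>x. f (e * x) = (\<Sum>g\<leftarrow>gs. g x))"
  using assms
proof (induction m arbitrary: e rule: less_induct)
  case (less m)
  show ?case
  proof (cases "null e")
    case True
    then have "m = 0" using null_imp_f[OF True] less.prems(2) by simp
    then show ?thesis using True by (simp add: null_def)
  next
    case False
    then have m: "m \<noteq> 0"
      using idempotent_value[OF less.prems(1) False] less.prems(2)
      by (metis atLeastAtMost_iff not_one_le_zero of_nat_eq_iff)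
    show ?thesis
    proof (cases "\<forall>b. \<exists>c. null (e * b - scale c e)")
      case True
      then obtain c where c: "\<And>b. null (e * b - scale (c b) e)" by metis
      \<comment> \<open>Taking \<open>y = 1\<close> identifies \<open>c x\<close> as
        \<open>f (e * x) / m\<close>, which is linear; general \<open>y\<close> gives
        multiplicativity.\<close>
      have ce: "f (e * x * y) = c x * f (e * y)" for x y
      proof -
        have "f ((e * x - scale (c x) e) * y) = 0" using c by (simp add: null_def)
        then show ?thesis by (simp add: left_diff_distrib diff scale_mult_left scale)
      qed
      have cf: "f (e * x) = of_nat m * c x" for x using ce[of x 1] less.prems(2) by simp
      then have c_def: "c x = f (e * x) / of_nat m" for x using m by simp
      have "Vector_Spaces.linear scale (*) c"
        unfolding Vector_Spaces.linear_iff c_def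
      proof (intro conjI allI)
        show "vector_space scale" by unfold_locales
        show "vector_space ((*) :: complex \<Rightarrow> complex \<Rightarrow> complex)"
          by unfold_locales (simp_all add: algebra_simps)
        show "f (e * (x + y)) / of_nat m = f (e * x) / of_nat m + f (e * y) / of_nat m" for x y
          by (simp add: distrib_left add add_divide_distrib)
        have "e * scale k x = scale k (e * x)" for k x
          using scale_mult_left[of k x e] by (simp add: mult.commute)
        then show "f (e * scale k x) / of_nat m = k * (f (e * x) / of_nat m)" for k x
          by (simp add: scale)
      qed
      moreover have "c 1 = 1" using c_def[of 1] less.prems(2) m by simp
      moreover have "c (x * y) = c x * c y" for x y
        using ce[of x y] cf[of y] cf[of "x * y"] m by (simp add: mult.assoc)
      ultimately have "algebra_hom scale c" by (simp add: algebra_hom_def complex_linear_def)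
      then show ?thesis using cf by (intro exI[of _ "replicate m c"]) (simp add: sum_list_replicate)
    next
      case nonscalar: False
      then obtain b where "\<And>c. \<not> null (e * b - scale c e)" by blast
      then obtain e' where e': "null (e' * e' - e')" "null ((e - e') * (e - e') - (e - e'))"
        "\<not> null e'" "\<not> null (e - e')"
        using split_idempotent[OF less.prems(1) False] by metis
      obtain k where k: "k \<in> {1..n}" "f e' = of_nat k"
        using idempotent_value[OF e'(1,3)] by metis
      obtain l where l: "l \<in> {1..n}" "f (e - e') = of_nat l"
        using idempotent_value[OF e'(2,4)] by metis
      \<comment> \<open>Since \<open>k\<close> and \<open>l\<close> are at least 1, both are smaller
        than \<open>m\<close>.\<close>
      have "(of_nat m :: complex) = of_nat (k + l)"
        using k l less.prems(2) by (simp add: diff algebra_simps)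
      then have kl: "m = k + l" by (simp only: of_nat_eq_iff)
      obtain gs where gs: "length gs = k" "\<forall>g\<in>set gs. algebra_hom scale g"
        "\<And>x. f (e' * x) = (\<Sum>g\<leftarrow>gs. g x)"
        using less.IH[OF _ e'(1) k(2)] kl l by auto
      obtain hs where hs: "length hs = l" "\<forall>g\<in>set hs. algebra_hom scale g"
        "\<And>x. f ((e - e') * x) = (\<Sum>g\<leftarrow>hs. g x)"
        using less.IH[OF _ e'(2) l(2)] kl k by auto
      have "f (e * x) = (\<Sum>g\<leftarrow>gs @ hs. g x)" for x
        using gs(3)[of x] hs(3)[of x] by (simp add: left_diff_distrib diff algebra_simps)
      then show ?thesis using gs hs kl by (intro exI[of _ "gs @ hs"]) auto
    qed
  qed
qed

end

theorem theorem3p4: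
  fixes scale :: "complex \<Rightarrow> 'a::comm_ring_1 \<Rightarrow> 'a"
    and f :: "'a \<Rightarrow> complex"
    and n :: nat
  assumes "complex_algebra scale"
    and "finitely_generated scale"
    and "frobenius_hom scale n f"
  shows "\<exists>g :: nat \<Rightarrow> 'a \<Rightarrow> complex.
           (\<forall>i\<in>{1..n}. algebra_hom scale (g i)) \<and> (\<forall>x. f x = (\<Sum>i\<in>{1..n}. g i x))"
proof -
  interpret frobenius scale n f
    using assms(1,3) by (simp add: frobenius_def frobenius_axioms_def)
  have "f 1 = of_nat n" using assms(3) by (simp add: frobenius_hom_def)
  \<comment> \<open>For \<open>e = 1\<close> the idempotent condition reads
    \<open>null 0\<close>.\<close>
  then obtain gs where gs: "length gs = n" "\<forall>g\<in>set gs. algebra_hom scale g"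
    "\<And>x. f x = (\<Sum>g\<leftarrow>gs. g x)"
    using corner_sum_of_homs[of 1 n] by (auto simp: null_def zero)
  have "f x = (\<Sum>i\<in>{1..n}. (gs ! (i - 1)) x)" for x
  proof -
    have "f x = (\<Sum>i<n. (gs ! i) x)"
      using gs(1) by (simp add: gs(3) sum_list_sum_nth atLeast0LessThan)
    also have "\<dots> = (\<Sum>i\<in>{1..n}. (gs ! (i - 1)) x)"
      by (rule sum.reindex_bij_witness[of _ "\<lambda>i. i - 1" Suc]) auto
    finally show ?thesis .
  qed
  moreover have "\<forall>i\<in>{1..n}. algebra_hom scale (gs ! (i - 1))" using gs by auto
  ultimately show ?thesis by (intro exI[of _ "\<lambda>i. gs ! (i - 1)"]) blast
qed

end
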